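(* Let $\mathcal{M}$ be a simplicial mesh of $\Omega$, $H_{\mathcal{M}}(\Omega)$ the space of functions constant on each $K\in\mathcal{M}$, $N\ge1$ an integer, $0<T<\infty$, $\delta t=T/N$, and let $\|\cdot\|_*$ be a norm on $H_{\mathcal{M}}(\Omega)$ with dual norm $\|\cdot\|^*$ with respect to the $L^2$-inner product. Let $u=(u^n)_{0\le n\le N}$, $u^n\in H_{\mathcal{M}}(\Omega)$, with associated function $u(x,t)=u^n(x)$ for $t^n\le t<t^{n+1}$, $0\le n\le N-1$, and let $\tau$ be a real number. Denote by $\hat u$ the extension by zero of the function $u$ from $\Omega\times[0,T)$ to $\mathbb{R}^d\times\mathbb{R}$. Then \[ \|\hat u(\cdot,\cdot+\tau)-\hat u(\cdot,\cdot)\|_{L^2(\mathbb{R}^d\times\mathbb{R})}^2\le|\tau|\,\Bigl[2\,\|u\|_{L^2(0,T;H_{\mathcal{M},*})}^2+\tfrac12\,\|\partial_{t,\mathcal{D}}(u)\|_{L^2(0,T;H_{\mathcal{M}}^* )}^2+2\,\|u\|_{L^\infty(0,T;L^2(\Omega))}^2\Bigr]. \]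
   Context: $\Omega\subset\mathbb{R}^d$ ($d=2$ or $3$) is a connected bounded open polygonal/polyhedral set, and $\mathcal{M}$ is a finite collection of pairwise disjoint (open) $d$-simplices with $\bar\Omega=\cup_{K\in\mathcal{M}}\bar K$, conforming (two neighbouring simplices share a whole face), and such that the circumcenter of each $K\in\mathcal{M}$ lies in $K$. $t^n=n\,\delta t$ for $0\le n\le N$. The dual norm is \[ \|u\|^*=\sup_{v\in H_{\mathcal{M}}(\Omega),\,v\ne0}\frac{\int_\Omega u\,v\,dx}{\|v\|_*},\qquad u\in H_{\mathcal{M}}(\Omega). \] The discrete time derivative $\partial_{t,\mathcal{D}}(u)$ is given by $\partial_{t,\mathcal{D}}(u)^n=(u^{n+1}-u^n)/\delta t$ for $0\le n\le N-1$. The space-time norms are \[ \|u\|_{L^2(0,T;H_{\mathcal{M},*})}^2=\sum_{n=0}^N\delta t\,\|u^n\|_*^2,\qquad \|v\|_{L^2(0,T;H_{\mathcal{M}}^* )}^2=\sum_{n=0}^{N-1}\delta t\,(\|v^n\|^* )^2, \] and $\|u\|_{L^\infty(0,T;L^2(\Omega))}=\max_{0\le n\le N-1}\|u^n\|_{L^2(\Omega)}$. *)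

theory Defs
  imports "HOL-Analysis.Analysis"
begin

section \<open>Simplicial meshes\<close>

text \<open>The library predicate \<open>polyhedron\<close> is restricted to convex sets, so a (not necessarily
  convex) polygonal or polyhedral domain is described by its boundary.\<close>

definition polyhedral_domain :: "'a::euclidean_space set \<Rightarrow> bool" where
  "polyhedral_domain \<Omega> \<longleftrightarrow> open \<Omega> \<and> connected \<Omega> \<and> bounded \<Omega> \<and>
     (\<exists>F. finite F \<and> frontier \<Omega> = \<Union>F \<and>
        (\<forall>f\<in>F. polytope f \<and> aff_dim f = int DIM('a) - 1))"

definition open_simplex :: "'a::euclidean_space set \<Rightarrow> bool" where
  "open_simplex K \<longleftrightarrow> (\<exists>S. int DIM('a) simplex S \<and> K = interior S)"

text \<open>The vertices of an open simplex are the extreme points of its closure; the point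
  equidistant from them is unique because the simplex is full-dimensional.\<close>

definition is_circumcenter :: "'a::euclidean_space \<Rightarrow> 'a set \<Rightarrow> bool" where
  "is_circumcenter c K \<longleftrightarrow> (\<exists>r. \<forall>v. v extreme_point_of closure K \<longrightarrow> dist c v = r)"

text \<open>Two simplices are neighbours if their closures meet in a set of dimension \<open>d - 1\<close>.\<close>

definition simplicial_mesh :: "'a::euclidean_space set \<Rightarrow> 'a set set \<Rightarrow> bool" where
  "simplicial_mesh \<Omega> M \<longleftrightarrow>
     finite M \<and> (\<forall>K\<in>M. open_simplex K) \<and> disjoint M \<and>
     closure \<Omega> = (\<Union>K\<in>M. closure K) \<and>
     (\<forall>K\<in>M. \<forall>L\<in>M. K \<noteq> L \<and> aff_dim (closure K \<inter> closure L) = int DIM('a) - 1 \<longrightarrow>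
        (closure K \<inter> closure L) facet_of closure K \<and>
        (closure K \<inter> closure L) facet_of closure L) \<and>
     (\<forall>K\<in>M. \<exists>c\<in>K. is_circumcenter c K)"

section \<open>Piecewise constant functions and their norms\<close>

text \<open>Such functions are only determined up to the null set \<open>\<Omega> - \<Union>M\<close>. Each class is represented
  by its member vanishing outside \<open>\<Union>M\<close>, so that the zero function is the only null element.\<close>

definition H_mesh :: "'a::euclidean_space set set \<Rightarrow> ('a \<Rightarrow> real) set" where
  "H_mesh M = {v. (\<forall>K\<in>M. v constant_on K) \<and> (\<forall>x. x \<notin> \<Union>M \<longrightarrow> v x = 0)}"

definition norm_on :: "('a \<Rightarrow> real) set \<Rightarrow> (('a \<Rightarrow> real) \<Rightarrow> real) \<Rightarrow> bool" where
  "norm_on V \<nu> \<longleftrightarrow>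
     (\<forall>v\<in>V. 0 \<le> \<nu> v \<and> (\<nu> v = 0 \<longleftrightarrow> v = (\<lambda>x. 0))) \<and>
     (\<forall>v\<in>V. \<forall>c. \<nu> (\<lambda>x. c * v x) = \<bar>c\<bar> * \<nu> v) \<and>
     (\<forall>v\<in>V. \<forall>w\<in>V. \<nu> (\<lambda>x. v x + w x) \<le> \<nu> v + \<nu> w)"

definition L2_norm :: "'a::euclidean_space set \<Rightarrow> ('a \<Rightarrow> real) \<Rightarrow> real" where
  "L2_norm S f = sqrt (LINT x:S|lborel. (f x)\<^sup>2)"

definition dual_norm ::
  "'a::euclidean_space set \<Rightarrow> 'a set set \<Rightarrow> (('a \<Rightarrow> real) \<Rightarrow> real) \<Rightarrow> ('a \<Rightarrow> real) \<Rightarrow> real" where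
  "dual_norm \<Omega> M \<nu> u = (SUP v\<in>H_mesh M - {\<lambda>x. 0}. (LINT x:\<Omega>|lborel. u x * v x) / \<nu> v)"

section \<open>Discrete functions of space and time\<close>

definition discrete_dt :: "real \<Rightarrow> (nat \<Rightarrow> 'a \<Rightarrow> real) \<Rightarrow> nat \<Rightarrow> 'a \<Rightarrow> real" where
  "discrete_dt \<delta>t u n = (\<lambda>x. (u (n + 1) x - u n x) / \<delta>t)"

definition L2_H_norm ::
  "(('a \<Rightarrow> real) \<Rightarrow> real) \<Rightarrow> real \<Rightarrow> nat \<Rightarrow> (nat \<Rightarrow> 'a \<Rightarrow> real) \<Rightarrow> real" where
  "L2_H_norm \<nu> \<delta>t N u = sqrt (\<Sum>n=0..N. \<delta>t * (\<nu> (u n))\<^sup>2)"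

definition L2_H_dual_norm ::
  "'a::euclidean_space set \<Rightarrow> 'a set set \<Rightarrow> (('a \<Rightarrow> real) \<Rightarrow> real) \<Rightarrow> real \<Rightarrow> nat \<Rightarrow>
    (nat \<Rightarrow> 'a \<Rightarrow> real) \<Rightarrow> real" where
  "L2_H_dual_norm \<Omega> M \<nu> \<delta>t N v = sqrt (\<Sum>n=0..N-1. \<delta>t * (dual_norm \<Omega> M \<nu> (v n))\<^sup>2)"

definition Linf_L2_norm ::
  "'a::euclidean_space set \<Rightarrow> nat \<Rightarrow> (nat \<Rightarrow> 'a \<Rightarrow> real) \<Rightarrow> real" where
  "Linf_L2_norm \<Omega> N u = (MAX n\<in>{0..N-1}. L2_norm \<Omega> (u n))"

definition spacetime_fun :: "real \<Rightarrow> (nat \<Rightarrow> 'a \<Rightarrow> real) \<Rightarrow> 'a \<times> real \<Rightarrow> real" where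
  "spacetime_fun \<delta>t u = (\<lambda>(x, t). u (nat \<lfloor>t / \<delta>t\<rfloor>) x)"

lemma spacetime_fun_eq:
  assumes "0 < \<delta>t" "real n * \<delta>t \<le> t" "t < real (n + 1) * \<delta>t"
  shows "spacetime_fun \<delta>t u (x, t) = u n x"
proof -
  have "\<lfloor>t / \<delta>t\<rfloor> = int n"
    using assms by (intro floor_unique) (auto simp: field_simps)
  then show ?thesis
    by (simp add: spacetime_fun_def)
qed

definition zero_extension :: "'b set \<Rightarrow> ('b \<Rightarrow> real) \<Rightarrow> 'b \<Rightarrow> real" where
  "zero_extension S f = (\<lambda>z. if z \<in> S then f z else 0)"

end

(* For tau >= 0 and a time t, let i and j be the time steps of t + tau and of t. If both lie in
   {0..<N}, then |u^i - u^j|^2 = sum_{j <= n < i} dt <d_t u^n, u^i - u^j>, and duality with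
   Young's inequality bounds each summand by dt (1/2 D_n^2 + |u^i|_*^2 + |u^j|_*^2), where D_n
   is the dual norm of d_t u^n. If only one of i and j lies in {0..<N}, then t belongs to one
   of two intervals of length tau and the increment is u^i or -u^j. In the integral over t,
   every jump n is met on an interval of length tau, and the number of jumps between t and t +
   tau integrates to tau over all t with t (or t + tau) in a given step. Translation in time
   reduces tau < 0 to this case. The supremum that defines the dual norm is finite because all
   norms on the finite-dimensional space H_mesh M are equivalent. *)

theory Submission imports Defs begin

section \<open>The space of piecewise constant functions\<close>

text \<open>The coefficient vectors with absolute sum 1 form a compact set. On it
  \<open>\<nu>\<close> of the combination is continuous and, by independence, nowhere zero, so its
  minimum there is a positive \<open>m\<close>; homogeneity extends the bound to all
  coefficients.\<close>

lemma norm_on_lower_bound: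
  fixes \<nu> :: "('a \<Rightarrow> real) \<Rightarrow> real" and b :: "'i \<Rightarrow> 'a \<Rightarrow> real"
  assumes \<nu>: "norm_on V \<nu>" and fin: "finite I"
    and span: "\<And>c. (\<lambda>x. \<Sum>i\<in>I. c i * b i x) \<in> V"
    and indep: "\<And>c. (\<lambda>x. \<Sum>i\<in>I. c i * b i x) = (\<lambda>x. 0) \<Longrightarrow> \<forall>i\<in>I. c i = 0"
  obtains m where "0 < m" "\<And>c. m * (\<Sum>i\<in>I. \<bar>c i\<bar>) \<le> \<nu> (\<lambda>x. \<Sum>i\<in>I. c i * b i x)"
proof -
  define L where "L c = (\<lambda>x. \<Sum>i\<in>I. c i * b i x)" for c
  have nonneg: "0 \<le> \<nu> v" and zero: "\<nu> v = 0 \<longleftrightarrow> v = (\<lambda>x. 0)"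
    and scale: "\<nu> (\<lambda>x. a * v x) = \<bar>a\<bar> * \<nu> v"
    if "v \<in> V" for v a
    using \<nu> that unfolding norm_on_def by auto
  have tri: "\<nu> (\<lambda>x. v x + w x) \<le> \<nu> v + \<nu> w" if "v \<in> V" "w \<in> V" for v w
    using \<nu> that unfolding norm_on_def by auto
  have LV: "L c \<in> V" for c
    unfolding L_def by (rule span)
  \<comment> \<open>Coefficients are padded by 0 outside \<open>J\<close>. This puts the zero
    function, each \<open>b i\<close> and the partial sums of the induction below into
    \<open>V\<close>.\<close>
  have sub: "(\<lambda>x. \<Sum>i\<in>J. c i * b i x) \<in> V" if "J \<subseteq> I" for c J
  proof -
    have "I \<inter> J = J" using that by auto
    moreover have "(\<Sum>i\<in>I. (if i \<in> J then c i else 0) * b i x)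
        = (\<Sum>i\<in>I \<inter> J. c i * b i x)" for x
      by (subst sum.inter_restrict[OF fin]) (rule sum.cong, auto)
    ultimately show ?thesis
      using span[of "\<lambda>i. if i \<in> J then c i else 0"] by simp
  qed
  have bV: "b i \<in> V" if "i \<in> I" for i
    using sub[of "{i}" "\<lambda>i. 1"] that by simp
  have upper: "\<nu> (L c) \<le> (\<Sum>i\<in>I. \<bar>c i\<bar> * \<nu> (b i))" for c
  proof -
    have "J \<subseteq> I \<Longrightarrow> \<nu> (\<lambda>x. \<Sum>i\<in>J. c i * b i x) \<le> (\<Sum>i\<in>J. \<bar>c i\<bar> * \<nu> (b i))"
      if "finite J" for J
      using that
    proof (induction J)
      case empty
      have "(\<lambda>x. 0) \<in> V" using sub[of "{}"] by simp
      then show ?case using zero[of "\<lambda>x. 0"] by simp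
    next
      case (insert j J)
      have "(\<lambda>x. c j * b j x) \<in> V" using sub[of "{j}" c] insert by simp
      then have "\<nu> (\<lambda>x. c j * b j x + (\<Sum>i\<in>J. c i * b i x))
          \<le> \<nu> (\<lambda>x. c j * b j x) + \<nu> (\<lambda>x. \<Sum>i\<in>J. c i * b i x)"
        using tri sub insert by simp
      also have "\<dots> \<le> \<bar>c j\<bar> * \<nu> (b j) + (\<Sum>i\<in>J. \<bar>c i\<bar> * \<nu> (b i))"
        using insert scale bV by simp
      finally show ?case using insert by simp
    qed
    then show ?thesis using fin by (simp add: L_def)
  qed
  have Lip1: "\<nu> (L c) - \<nu> (L c') \<le> (\<Sum>i\<in>I. \<bar>c i - c' i\<bar> * \<nu> (b i))" for c c'
  proof -
    have "L c = (\<lambda>x. L c' x + L (\<lambda>i. c i - c' i) x)"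
      by (simp add: L_def sum.distrib[symmetric] algebra_simps)
    then have "\<nu> (L c) \<le> \<nu> (L c') + \<nu> (L (\<lambda>i. c i - c' i))"
      using tri[OF LV LV] by metis
    then show ?thesis using upper[of "\<lambda>i. c i - c' i"] by simp
  qed
  have Lip: "\<bar>\<nu> (L c) - \<nu> (L c')\<bar> \<le> (\<Sum>i\<in>I. \<bar>c i - c' i\<bar> * \<nu> (b i))" for c c'
    using Lip1[of c c'] Lip1[of c' c] by (simp add: abs_minus_commute)
  \<comment> \<open>Coefficient functions carry the product topology. The bound \<open>Lip\<close>
    involves only the finitely many coordinates in \<open>I\<close>, so it tends to 0 as
    \<open>c\<close> tends to \<open>c'\<close>.\<close>
  have coord: "continuous_on UNIV (\<lambda>c::'i \<Rightarrow> real. c i)" for i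
    by (rule continuous_on_product_coordinates)
  have cont: "continuous_on UNIV (\<lambda>c. \<nu> (L c))"
    unfolding continuous_on_def
  proof
    fix c' :: "'i \<Rightarrow> real"
    have "continuous_on UNIV (\<lambda>c. \<Sum>i\<in>I. \<bar>c i - c' i\<bar> * \<nu> (b i))"
      by (intro continuous_intros coord)
    then have "((\<lambda>c. \<Sum>i\<in>I. \<bar>c i - c' i\<bar> * \<nu> (b i)) \<longlongrightarrow> (\<Sum>i\<in>I. \<bar>c' i - c' i\<bar> * \<nu> (b i))) (at c')"
      unfolding continuous_on_def by blast
    then have "((\<lambda>c. \<Sum>i\<in>I. \<bar>c i - c' i\<bar> * \<nu> (b i)) \<longlongrightarrow> 0) (at c')"
      by simp
    then have "((\<lambda>c. \<nu> (L c) - \<nu> (L c')) \<longlongrightarrow> 0) (at c')"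
      by (rule Lim_null_comparison[rotated]) (simp add: Lip)
    then show "((\<lambda>c. \<nu> (L c)) \<longlongrightarrow> \<nu> (L c')) (at c')"
      using Lim_null by blast
  qed
  \<comment> \<open>Coefficients outside \<open>I\<close> are pinned to 0; otherwise they would be
    unbounded and \<open>S\<close> would not be compact.\<close>
  define S where "S = {c::'i \<Rightarrow> real. (\<forall>i. i \<notin> I \<longrightarrow> c i = 0) \<and> (\<Sum>i\<in>I. \<bar>c i\<bar>) = 1}"
  show thesis
  proof (cases "I = {}")
    \<comment> \<open>Here \<open>S\<close> is empty, but every combination is the zero function and
      any positive constant serves.\<close>
    case True
    have "L (\<lambda>i. 0) \<in> V" by (rule LV)
    then show thesis
      using that[of 1] True nonneg by (simp add: L_def)
  next
    case False
    then obtain i0 where i0: "i0 \<in> I" by blast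
    \<comment> \<open>A product of compact intervals, compact by Tychonoff; \<open>S\<close> is a
      closed subset of it.\<close>
    define P where "P = (Pi\<^sub>E UNIV (\<lambda>i. if i \<in> I then {-1..1::real} else {0}))"
    have "compact P"
      unfolding P_def compactin_euclidean_iff[symmetric] euclidean_product_topology[symmetric]
      by (subst compactin_PiE) auto
    moreover have "closed {c::'i \<Rightarrow> real. (\<Sum>i\<in>I. \<bar>c i\<bar>) = 1}"
      by (intro closed_Collect_eq continuous_intros coord)
    moreover have "S = P \<inter> {c. (\<Sum>i\<in>I. \<bar>c i\<bar>) = 1}"
    proof -
      have "\<bar>c i\<bar> \<le> 1" if "(\<Sum>i\<in>I. \<bar>c i\<bar>) = 1" "i \<in> I" for c :: "'i \<Rightarrow> real" and i
        using member_le_sum[OF that(2), of "\<lambda>i. \<bar>c i\<bar>"] fin that(1) by simp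
      then show ?thesis
        by (auto simp: S_def P_def PiE_iff abs_le_iff split: if_splits)
    qed
    ultimately have "compact S"
      by (simp add: compact_Int_closed)
    moreover have "(\<lambda>i. if i = i0 then 1 else 0) \<in> S"
      using i0 fin by (auto simp: S_def if_distrib sum.delta cong: if_cong)
    ultimately obtain c0 where c0: "c0 \<in> S" "\<And>c. c \<in> S \<Longrightarrow> \<nu> (L c0) \<le> \<nu> (L c)"
      using continuous_attains_inf[of S "\<lambda>c. \<nu> (L c)"] continuous_on_subset[OF cont subset_UNIV]
      by blast
    have "\<nu> (L c0) \<noteq> 0"
    proof
      assume "\<nu> (L c0) = 0"
      then have "\<forall>i\<in>I. c0 i = 0"
        using zero[OF LV] indep unfolding L_def by blast
      then show False using c0(1) by (simp add: S_def)
    qed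
    then have pos: "0 < \<nu> (L c0)"
      using nonneg[OF LV, of c0] by simp
    have "\<nu> (L c0) * (\<Sum>i\<in>I. \<bar>c i\<bar>) \<le> \<nu> (L c)" for c
    proof -
      define s where "s = (\<Sum>i\<in>I. \<bar>c i\<bar>)"
      have s0: "0 \<le> s" unfolding s_def by (simp add: sum_nonneg)
      show ?thesis
      proof (cases "s = 0")
        case True
        then show ?thesis using nonneg[OF LV, of c] by (simp add: s_def)
      next
        case False
        \<comment> \<open>The coefficients rescaled to lie in \<open>S\<close>; the factor
          \<open>s\<close> comes out of \<open>\<nu>\<close> by homogeneity.\<close>
        define c1 where "c1 i = (if i \<in> I then c i / s else 0)" for i
        have "(\<Sum>i\<in>I. \<bar>c1 i\<bar>) = (\<Sum>i\<in>I. \<bar>c i\<bar>) / s"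
          using s0 by (simp add: c1_def sum_divide_distrib)
        then have "c1 \<in> S"
          using False by (simp add: S_def s_def[symmetric] c1_def)
        then have "\<nu> (L c0) \<le> \<nu> (L c1)" by (rule c0(2))
        moreover have "L c = (\<lambda>x. s * L c1 x)"
          using False by (simp add: L_def c1_def sum_distrib_left)
        then have "\<nu> (L c) = s * \<nu> (L c1)"
          using scale[OF LV, of s c1] s0 by simp
        ultimately show ?thesis
          using s0 by (simp add: s_def[symmetric] mult.commute mult_left_mono)
      qed
    qed
    then show thesis using that pos unfolding L_def by blast
  qed
qed

section \<open>Mesh functions as combinations of cell indicators, and their bounds\<close>

lemma H_mesh_sum_indicator:
  assumes "finite M" "disjoint M" "v \<in> H_mesh M"
  shows "v x = (\<Sum>K\<in>M. v (SOME y. y \<in> K) * indicator K x)"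
proof (cases "x \<in> \<Union>M")
  case True
  then obtain K where K: "K \<in> M" "x \<in> K" by blast
  \<comment> \<open>The chosen point samples the constant value on the cell. For an empty cell the
    choice is arbitrary, but there the indicator vanishes.\<close>
  have "(SOME y. y \<in> K) \<in> K" using K(2) by (rule someI)
  then have v: "v (SOME y. y \<in> K) = v x"
    using assms(3) K unfolding H_mesh_def constant_on_def by fastforce
  have "x \<notin> L" if "L \<in> M - {K}" for L
    using K that assms(2) unfolding disjoint_def by blast
  then have "(\<Sum>L\<in>M. v (SOME y. y \<in> L) * indicator L x) = v (SOME y. y \<in> K) * indicator K x"
    using K assms(1) by (subst sum.remove[OF assms(1) K(1)]) simp
  then show ?thesis using v K by simp
next
  case False
  then show ?thesis
    using assms(3) by (auto simp: H_mesh_def indicator_def intro!: sum.neutral)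
qed

lemma sum_indicator_in_H_mesh:
  assumes "disjoint M"
  shows "(\<lambda>x. \<Sum>K\<in>M. c K * indicator K x) \<in> H_mesh M"
proof -
  have "(\<lambda>x. \<Sum>L\<in>M. c L * indicator L x) constant_on K" if K: "K \<in> M" for K
    unfolding constant_on_def
  proof (intro exI ballI)
    fix x assume "x \<in> K"
    then have "indicator L x = (if L = K then 1 else 0 :: real)" if "L \<in> M" for L
      using K that assms unfolding disjoint_def indicator_def by auto
    then show "(\<Sum>L\<in>M. c L * indicator L x) = (\<Sum>L\<in>M. c L * (if L = K then 1 else 0))"
      by (intro sum.cong) simp_all
  qed
  then show ?thesis
    by (auto simp: H_mesh_def indicator_def intro!: sum.neutral)
qed

lemma H_mesh_diff:
  assumes "v \<in> H_mesh M" "w \<in> H_mesh M"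
  shows "(\<lambda>x. v x - w x) \<in> H_mesh M"
proof -
  have "(\<lambda>x. v x - w x) constant_on K" if K: "K \<in> M" for K
  proof -
    obtain a where "\<forall>x\<in>K. v x = a"
      using assms(1) K unfolding H_mesh_def constant_on_def by blast
    moreover obtain b where "\<forall>x\<in>K. w x = b"
      using assms(2) K unfolding H_mesh_def constant_on_def by blast
    ultimately show ?thesis unfolding constant_on_def by auto
  qed
  then show ?thesis using assms by (simp add: H_mesh_def)
qed

lemma H_mesh_scale:
  assumes "v \<in> H_mesh M"
  shows "(\<lambda>x. c * v x) \<in> H_mesh M"
proof -
  have "(\<lambda>x. c * v x) constant_on K" if K: "K \<in> M" for K
  proof -
    obtain a where "\<forall>x\<in>K. v x = a"
      using assms K unfolding H_mesh_def constant_on_def by blast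
    then show ?thesis unfolding constant_on_def by auto
  qed
  then show ?thesis using assms by (simp add: H_mesh_def)
qed

lemma zero_in_H_mesh: "(\<lambda>x. 0) \<in> H_mesh M"
  by (simp add: H_mesh_def constant_on_def)

text \<open>The indicators of nonempty disjoint cells are independent: evaluation at a point of a
  cell isolates its coefficient. So \<open>\<nu>\<close> controls the absolute sum of the cell
  values, which dominates the maximum norm.\<close>

lemma H_mesh_le_norm:
  assumes "finite M" "disjoint M" "{} \<notin> M" "norm_on (H_mesh M) \<nu>"
  obtains C where "0 \<le> C" "\<And>v x. v \<in> H_mesh M \<Longrightarrow> \<bar>v x\<bar> \<le> C * \<nu> v"
proof -
  have indep: "\<forall>K\<in>M. c K = 0" if z: "(\<lambda>x. \<Sum>K\<in>M. c K * indicator K x) = (\<lambda>x. 0)"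
    for c :: "'a set \<Rightarrow> real"
  proof
    fix K assume K: "K \<in> M"
    then obtain x where x: "x \<in> K" using assms(3) by (cases "K = {}") auto
    have "x \<notin> L" if "L \<in> M - {K}" for L
      using K x that assms(2) unfolding disjoint_def by blast
    then have "(\<Sum>L\<in>M. c L * indicator L x) = c K"
      using x by (subst sum.remove[OF assms(1) K]) simp
    then show "c K = 0" using fun_cong[OF z, of x] by simp
  qed
  obtain m where m: "0 < m"
    "\<And>c. m * (\<Sum>K\<in>M. \<bar>c K\<bar>) \<le> \<nu> (\<lambda>x. \<Sum>K\<in>M. c K * indicator K x)"
    using norm_on_lower_bound[OF assms(4,1), where b = indicator]
      sum_indicator_in_H_mesh[OF assms(2)] indep by blast
  show thesis
  proof
    show "0 \<le> 1 / m" using m by simp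
    fix v x assume v: "v \<in> H_mesh M"
    define c where "c K = v (SOME y. y \<in> K)" for K
    have rep: "v = (\<lambda>x. \<Sum>K\<in>M. c K * indicator K x)"
      unfolding c_def by (rule ext, rule H_mesh_sum_indicator) (use assms v in auto)
    have "\<bar>v x\<bar> \<le> (\<Sum>K\<in>M. \<bar>c K * indicator K x\<bar>)"
      by (subst rep) (rule sum_abs)
    also have "\<dots> \<le> (\<Sum>K\<in>M. \<bar>c K\<bar>)"
      by (rule sum_mono) (simp add: indicator_def)
    also have "\<dots> \<le> 1 / m * \<nu> v"
      using m(2)[of c] m(1) rep by (simp add: field_simps)
    finally show "\<bar>v x\<bar> \<le> 1 / m * \<nu> v" .
  qed
qed

lemma H_mesh_borel_measurable:
  assumes "finite M" "disjoint M" "\<And>K. K \<in> M \<Longrightarrow> open K" "v \<in> H_mesh M"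
  shows "v \<in> borel_measurable borel"
proof -
  have "(\<lambda>x. \<Sum>K\<in>M. v (SOME y. y \<in> K) * indicator K x) \<in> borel_measurable borel"
    using assms(3) by measurable
  moreover have "(\<lambda>x. \<Sum>K\<in>M. v (SOME y. y \<in> K) * indicator K x) = v"
    by (rule ext, rule H_mesh_sum_indicator[OF assms(1,2,4), symmetric])
  ultimately show ?thesis by simp
qed

lemma H_mesh_bounded:
  assumes "finite M" "disjoint M" "v \<in> H_mesh M"
  obtains B where "0 \<le> B" "\<And>x. \<bar>v x\<bar> \<le> B"
proof
  show "0 \<le> (\<Sum>K\<in>M. \<bar>v (SOME y. y \<in> K)\<bar>)" by (simp add: sum_nonneg)
  fix x
  have "\<bar>v x\<bar> \<le> (\<Sum>K\<in>M. \<bar>v (SOME y. y \<in> K) * indicator K x\<bar>)"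
    by (subst H_mesh_sum_indicator[OF assms]) (rule sum_abs)
  also have "\<dots> \<le> (\<Sum>K\<in>M. \<bar>v (SOME y. y \<in> K)\<bar>)"
    by (rule sum_mono) (simp add: indicator_def)
  finally show "\<bar>v x\<bar> \<le> (\<Sum>K\<in>M. \<bar>v (SOME y. y \<in> K)\<bar>)" .
qed

section \<open>Inner product, dual norm and increments between time steps\<close>

locale mesh_norm =
  fixes \<Omega> :: "'a::euclidean_space set" and M :: "'a set set" and \<nu> :: "('a \<Rightarrow> real) \<Rightarrow> real"
  assumes open_domain: "open \<Omega>" and bounded_domain: "bounded \<Omega>"
    and finite_mesh: "finite M" and disjoint_mesh: "disjoint M" and nonempty_cells: "{} \<notin> M"
    and open_cells: "\<And>K. K \<in> M \<Longrightarrow> open K"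
    and norm_on_mesh: "norm_on (H_mesh M) \<nu>"
begin

definition ip :: "('a \<Rightarrow> real) \<Rightarrow> ('a \<Rightarrow> real) \<Rightarrow> real" where
  "ip v w = (LINT x:\<Omega>|lborel. v x * w x)"

lemma measurable_H_mesh: "v \<in> H_mesh M \<Longrightarrow> v \<in> borel_measurable borel"
  by (rule H_mesh_borel_measurable[OF finite_mesh disjoint_mesh open_cells])

lemma integrable_ip:
  assumes "v \<in> H_mesh M" "w \<in> H_mesh M"
  shows "set_integrable lborel \<Omega> (\<lambda>x. v x * w x)"
proof -
  obtain A B where A: "0 \<le> A" "\<And>x. \<bar>v x\<bar> \<le> A" and B: "0 \<le> B" "\<And>x. \<bar>w x\<bar> \<le> B"
    using H_mesh_bounded[OF finite_mesh disjoint_mesh] assms by metis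
  have [measurable]: "v \<in> borel_measurable borel" "w \<in> borel_measurable borel" "\<Omega> \<in> sets borel"
    using measurable_H_mesh assms open_domain by auto
  show ?thesis
    unfolding set_integrable_def
  proof (rule integrableI_bounded_set[where A = \<Omega> and B = "A * B"])
    show "emeasure lborel \<Omega> < \<infinity>"
      using bounded_domain by (rule emeasure_bounded_finite)
    show "AE x in lborel. x \<in> \<Omega> \<longrightarrow> norm (indicator \<Omega> x *\<^sub>R (v x * w x)) \<le> A * B"
      using A B by (simp add: abs_mult mult_mono)
  qed auto
qed

lemma ip_diff_left:
  assumes "v \<in> H_mesh M" "w \<in> H_mesh M" "z \<in> H_mesh M"
  shows "ip (\<lambda>x. v x - w x) z = ip v z - ip w z"
  unfolding ip_def using set_integral_diff(2)[OF integrable_ip integrable_ip] assms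
  by (simp add: left_diff_distrib)

lemma ip_scale_left: "ip (\<lambda>x. c * v x) w = c * ip v w"
  unfolding ip_def by (simp add: mult.assoc)

lemma ip_self: "ip v v = (L2_norm \<Omega> v)\<^sup>2"
  by (simp add: ip_def L2_norm_def power2_eq_square set_lebesgue_integral_def)

text \<open>A real supremum is an upper bound only if the quotients are bounded above. They are,
  since \<open>\<nu>\<close> dominates the maximum norm and the bounded set \<open>\<Omega>\<close>
  has finite measure. The supremum leaves out the zero function, which is treated
  separately.\<close>

lemma ip_le_dual_norm:
  assumes v: "v \<in> H_mesh M" and w: "w \<in> H_mesh M"
  shows "ip w v \<le> dual_norm \<Omega> M \<nu> w * \<nu> v"
proof (cases "v = (\<lambda>x. 0)")
  case True
  moreover have "\<nu> v = 0"
    using norm_on_mesh v True unfolding norm_on_def by blast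
  ultimately show ?thesis by (simp add: ip_def)
next
  case False
  obtain C where C: "0 \<le> C" "\<And>v x. v \<in> H_mesh M \<Longrightarrow> \<bar>v x\<bar> \<le> C * \<nu> v"
    using H_mesh_le_norm[OF finite_mesh disjoint_mesh nonempty_cells norm_on_mesh] by blast
  obtain B where B: "0 \<le> B" "\<And>x. \<bar>w x\<bar> \<le> B"
    using H_mesh_bounded[OF finite_mesh disjoint_mesh w] by blast
  have pos: "0 < \<nu> v" if "v \<in> H_mesh M - {\<lambda>x. 0}" for v
    using norm_on_mesh that unfolding norm_on_def by (force simp: less_le)
  have bound: "ip w v / \<nu> v \<le> B * C * measure lborel \<Omega>" if "v \<in> H_mesh M - {\<lambda>x. 0}" for v
  proof -
    have "ip w v \<le> (LINT x:\<Omega>|lborel. B * (C * \<nu> v))"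
      unfolding ip_def
    proof (rule set_integral_mono)
      show "set_integrable lborel \<Omega> (\<lambda>x. w x * v x)"
        using integrable_ip w that by blast
      show "set_integrable lborel \<Omega> (\<lambda>x. B * (C * \<nu> v))"
        using open_domain emeasure_bounded_finite[OF bounded_domain]
        by (simp add: set_integrable_def)
      fix x
      have "w x * v x \<le> \<bar>w x\<bar> * \<bar>v x\<bar>" by (metis abs_ge_self abs_mult)
      also have "\<dots> \<le> B * (C * \<nu> v)"
        using B C that by (intro mult_mono) auto
      finally show "w x * v x \<le> B * (C * \<nu> v)" .
    qed
    also have "\<dots> = B * C * measure lborel \<Omega> * \<nu> v"
      using open_domain emeasure_bounded_finite[OF bounded_domain]
      by (simp add: set_lebesgue_integral_def)
    finally show ?thesis using pos[OF that] by (simp add: divide_le_eq)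
  qed
  have "bdd_above ((\<lambda>v. ip w v / \<nu> v) ` (H_mesh M - {\<lambda>x. 0}))"
    using bound by (intro bdd_aboveI2)
  then have "ip w v / \<nu> v \<le> dual_norm \<Omega> M \<nu> w"
    unfolding dual_norm_def ip_def using v False by (intro cSUP_upper) auto
  then show ?thesis
    using pos v False by (simp add: divide_le_eq)
qed

lemma norm_diff_square_le:
  assumes "v \<in> H_mesh M" "w \<in> H_mesh M"
  shows "(\<nu> (\<lambda>x. v x - w x))\<^sup>2 \<le> 2 * (\<nu> v)\<^sup>2 + 2 * (\<nu> w)\<^sup>2"
proof -
  have tri: "\<nu> (\<lambda>x. a x + b x) \<le> \<nu> a + \<nu> b" if "a \<in> H_mesh M" "b \<in> H_mesh M" for a b
    using norm_on_mesh that unfolding norm_on_def by blast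
  \<comment> \<open>\<open>norm_on\<close> speaks of sums and multiples, so the difference is
    written as a sum with \<open>(-1) * w\<close>.\<close>
  have "\<nu> (\<lambda>x. v x + (-1) * w x) \<le> \<nu> v + \<nu> (\<lambda>x. (-1) * w x)"
    by (rule tri[OF assms(1) H_mesh_scale[OF assms(2), of "-1"]])
  moreover have "\<nu> (\<lambda>x. (-1) * w x) = \<bar>-1\<bar> * \<nu> w"
    using norm_on_mesh assms unfolding norm_on_def by blast
  ultimately have "\<nu> (\<lambda>x. v x - w x) \<le> \<nu> v + \<nu> w"
    by simp
  moreover have "0 \<le> \<nu> (\<lambda>x. v x - w x)"
    using norm_on_mesh H_mesh_diff[OF assms] unfolding norm_on_def by blast
  ultimately have "(\<nu> (\<lambda>x. v x - w x))\<^sup>2 \<le> (\<nu> v + \<nu> w)\<^sup>2"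
    by (intro power_mono)
  also have "\<dots> \<le> 2 * (\<nu> v)\<^sup>2 + 2 * (\<nu> w)\<^sup>2"
    using sum_squares_bound[of "\<nu> v" "\<nu> w"] by (simp add: power2_sum)
  finally show ?thesis .
qed

text \<open>The increment telescopes: each step adds \<open>\<delta>\<close> times the pairing of
  the discrete derivative with \<open>v\<close>, which duality and Young's inequality bound. The
  test function \<open>v\<close> is arbitrary because it must stay fixed while the induction moves
  \<open>i\<close>.\<close>

lemma ip_increment_le:
  assumes u: "\<And>n. n \<le> N \<Longrightarrow> u n \<in> H_mesh M" and "0 < \<delta>" "v \<in> H_mesh M" "j \<le> i" "i \<le> N"
  shows "ip (\<lambda>x. u i x - u j x) v
    \<le> (\<Sum>n\<in>{j..<i}. \<delta> / 2 * (dual_norm \<Omega> M \<nu> (discrete_dt \<delta> u n))\<^sup>2 + \<delta> / 2 * (\<nu> v)\<^sup>2)"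
  using assms(4,5)
proof (induction i rule: dec_induct)
  case base
  then show ?case by (simp add: ip_def)
next
  case (step i)
  let ?d = "discrete_dt \<delta> u i"
  have ui: "u i \<in> H_mesh M" "u (Suc i) \<in> H_mesh M" "u j \<in> H_mesh M"
    using u step by auto
  have dt: "?d = (\<lambda>x. (1 / \<delta>) * (u (Suc i) x - u i x))"
    by (auto simp: discrete_dt_def)
  have d: "?d \<in> H_mesh M"
    unfolding dt by (rule H_mesh_scale, rule H_mesh_diff) (use ui in auto)
  have eq: "ip (\<lambda>x. u (Suc i) x - u j x) v = ip (\<lambda>x. u i x - u j x) v + \<delta> * ip ?d v"
    using ui \<open>v \<in> H_mesh M\<close> \<open>0 < \<delta>\<close> unfolding dt ip_scale_left by (simp add: ip_diff_left)
  have "ip ?d v \<le> dual_norm \<Omega> M \<nu> ?d * \<nu> v"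
    using ip_le_dual_norm d \<open>v \<in> H_mesh M\<close> by blast
  also have "\<dots> \<le> 1 / 2 * (dual_norm \<Omega> M \<nu> ?d)\<^sup>2 + 1 / 2 * (\<nu> v)\<^sup>2"
    using sum_squares_bound[of "dual_norm \<Omega> M \<nu> ?d" "\<nu> v"] by simp
  finally have "\<delta> * ip ?d v \<le> \<delta> * (1 / 2 * (dual_norm \<Omega> M \<nu> ?d)\<^sup>2 + 1 / 2 * (\<nu> v)\<^sup>2)"
    using \<open>0 < \<delta>\<close> by (intro mult_left_mono) auto
  then show ?case
    using step eq by (simp add: algebra_simps)
qed

text \<open>The increment itself is taken as test function. Its \<open>\<nu>\<close>-square appears
  once per jump, hence the factor \<open>real i - real j\<close>, and splits into the contributions
  of its two end values.\<close>

lemma increment_le: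
  assumes u: "\<And>n. n \<le> N \<Longrightarrow> u n \<in> H_mesh M" and "0 < \<delta>" "j \<le> i" "i \<le> N"
  shows "(L2_norm \<Omega> (\<lambda>x. u i x - u j x))\<^sup>2
    \<le> (\<Sum>n\<in>{j..<i}. \<delta> / 2 * (dual_norm \<Omega> M \<nu> (discrete_dt \<delta> u n))\<^sup>2)
      + \<delta> * (\<nu> (u i))\<^sup>2 * (real i - real j) + \<delta> * (\<nu> (u j))\<^sup>2 * (real i - real j)"
proof -
  let ?v = "\<lambda>x. u i x - u j x"
  have ui: "u i \<in> H_mesh M" "u j \<in> H_mesh M"
    using u assms by auto
  have "ip ?v ?v
      \<le> (\<Sum>n\<in>{j..<i}. \<delta> / 2 * (dual_norm \<Omega> M \<nu> (discrete_dt \<delta> u n))\<^sup>2)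
        + (real i - real j) * (\<delta> / 2 * (\<nu> ?v)\<^sup>2)"
    using ip_increment_le[where v = ?v, OF u \<open>0 < \<delta>\<close> H_mesh_diff[OF ui] assms(3,4)] assms(3)
    by (simp add: sum.distrib)
  also have "(real i - real j) * (\<delta> / 2 * (\<nu> ?v)\<^sup>2)
      \<le> (real i - real j) * (\<delta> / 2 * (2 * (\<nu> (u i))\<^sup>2 + 2 * (\<nu> (u j))\<^sup>2))"
    using norm_diff_square_le[OF ui] assms by (intro mult_left_mono) auto
  finally show ?thesis
    unfolding ip_self by (simp add: algebra_simps)
qed

end

section \<open>Counting the jumps between two times\<close>

text \<open>For \<open>t\<close> in the \<open>m\<close>-th time step, the number of grid points in \<open>(t, t + \<tau>]\<close> is the integer part
  of \<open>\<tau> / \<delta>\<close>, plus one if \<open>t\<close> lies in the last part of the step, whose length is the remainder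
  of \<open>\<tau>\<close> modulo \<open>\<delta>\<close>. In \<open>jumps_before\<close> it is \<open>t + \<tau>\<close> that lies in the \<open>m\<close>-th step. Both functions
  have integral exactly \<open>\<tau>\<close>.\<close>

definition jumps_after :: "real \<Rightarrow> real \<Rightarrow> nat \<Rightarrow> real \<Rightarrow> real" where
  "jumps_after \<delta> \<tau> m t =
     of_int \<lfloor>\<tau> / \<delta>\<rfloor> * indicator {real m * \<delta>..<real m * \<delta> + \<delta>} t
     + indicator {real m * \<delta> + \<delta> - (\<tau> - of_int \<lfloor>\<tau> / \<delta>\<rfloor> * \<delta>)..<real m * \<delta> + \<delta>} t"

definition jumps_before :: "real \<Rightarrow> real \<Rightarrow> nat \<Rightarrow> real \<Rightarrow> real" where
  "jumps_before \<delta> \<tau> m t =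
     of_int \<lfloor>\<tau> / \<delta>\<rfloor> * indicator {real m * \<delta> - \<tau>..<real m * \<delta> + \<delta> - \<tau>} t
     + indicator {real m * \<delta> - \<tau>..<real m * \<delta> - of_int \<lfloor>\<tau> / \<delta>\<rfloor> * \<delta>} t"

lemma jumps_nonneg:
  assumes "0 < \<delta>" "0 \<le> \<tau>"
  shows "0 \<le> jumps_after \<delta> \<tau> m t" "0 \<le> jumps_before \<delta> \<tau> m t"
  using assms by (simp_all add: jumps_after_def jumps_before_def)

lemma floor_divide_eq_iff:
  fixes \<delta> :: real
  assumes "0 < \<delta>"
  shows "\<lfloor>t / \<delta>\<rfloor> = k \<longleftrightarrow> of_int k * \<delta> \<le> t \<and> t < of_int k * \<delta> + \<delta>"
  using assms by (simp add: floor_eq_iff field_simps)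

lemma jumps_after_eq:
  assumes "0 < \<delta>" "\<lfloor>t / \<delta>\<rfloor> = int m" "\<lfloor>(t + \<tau>) / \<delta>\<rfloor> = i"
  shows "jumps_after \<delta> \<tau> m t = of_int i - real m"
proof -
  define k where "k = \<lfloor>\<tau> / \<delta>\<rfloor>"
  have k: "of_int k * \<delta> \<le> \<tau>" "\<tau> < of_int k * \<delta> + \<delta>"
    using floor_divide_eq_iff[OF assms(1)] k_def by blast+
  have m: "real m * \<delta> \<le> t" "t < real m * \<delta> + \<delta>"
    using floor_divide_eq_iff[OF assms(1)] assms(2) by auto
  show ?thesis
  \<comment> \<open>With \<open>\<tau>\<close> equal to \<open>k\<close> full steps plus a
    remainder, the question is whether adding the remainder carries \<open>t\<close> over the end of
    step \<open>m\<close>.\<close>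
  proof (cases "real m * \<delta> + \<delta> - (\<tau> - of_int k * \<delta>) \<le> t")
    case True
    then have "\<lfloor>(t + \<tau>) / \<delta>\<rfloor> = int m + k + 1"
      unfolding floor_divide_eq_iff[OF assms(1)] using k m by (simp add: algebra_simps)
    then show ?thesis
      using True m assms(3) by (simp add: jumps_after_def k_def)
  next
    case False
    then have "\<lfloor>(t + \<tau>) / \<delta>\<rfloor> = int m + k"
      unfolding floor_divide_eq_iff[OF assms(1)] using k m by (simp add: algebra_simps)
    then show ?thesis
      using False m assms(3) by (simp add: jumps_after_def k_def)
  qed
qed

lemma jumps_before_eq:
  assumes "0 < \<delta>" "\<lfloor>t / \<delta>\<rfloor> = j" "\<lfloor>(t + \<tau>) / \<delta>\<rfloor> = int m"
  shows "jumps_before \<delta> \<tau> m t = real m - of_int j"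
proof -
  define k where "k = \<lfloor>\<tau> / \<delta>\<rfloor>"
  have k: "of_int k * \<delta> \<le> \<tau>" "\<tau> < of_int k * \<delta> + \<delta>"
    using floor_divide_eq_iff[OF assms(1)] k_def by blast+
  have m: "real m * \<delta> \<le> t + \<tau>" "t + \<tau> < real m * \<delta> + \<delta>"
    using floor_divide_eq_iff[OF assms(1)] assms(3) by auto
  show ?thesis
  \<comment> \<open>The mirror image: subtracting the remainder from \<open>t + \<tau>\<close>
    either falls below the start of step \<open>m\<close> or does not.\<close>
  proof (cases "t < real m * \<delta> - of_int k * \<delta>")
    case True
    then have "\<lfloor>t / \<delta>\<rfloor> = int m - k - 1"
      unfolding floor_divide_eq_iff[OF assms(1)] using k m by (simp add: algebra_simps)
    then show ?thesis
      using True m assms(2) by (simp add: jumps_before_def k_def)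
  next
    case False
    then have "\<lfloor>t / \<delta>\<rfloor> = int m - k"
      unfolding floor_divide_eq_iff[OF assms(1)] using k m by (simp add: algebra_simps)
    then show ?thesis
      using False m assms(2) by (simp add: jumps_before_def k_def)
  qed
qed

text \<open>The length is a separate variable, so that the rule applies to any expression equal to
  it.\<close>

lemma has_bochner_integral_indicator_Ico:
  fixes a b :: real
  assumes "a \<le> b" "c = b - a"
  shows "has_bochner_integral lborel (indicator {a..<b}) c"
  using has_bochner_integral_real_indicator[of "{a..<b}" lborel] assms by simp

lemma jumps_has_integral:
  assumes "0 < \<delta>"
  shows "has_bochner_integral lborel (jumps_after \<delta> \<tau> m) \<tau>"
    and "has_bochner_integral lborel (jumps_before \<delta> \<tau> m) \<tau>"
proof -
  define k where "k = \<lfloor>\<tau> / \<delta>\<rfloor>"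
  have k: "of_int k * \<delta> \<le> \<tau>" "\<tau> < of_int k * \<delta> + \<delta>"
    using floor_divide_eq_iff[OF assms(1)] k_def by blast+
  \<comment> \<open>A full step, of length \<open>\<delta>\<close>, is weighted by \<open>k\<close>,
    and the second interval has the length of the remainder; together they give
    \<open>\<tau>\<close>.\<close>
  have "has_bochner_integral lborel (jumps_after \<delta> \<tau> m) (of_int k * \<delta> + (\<tau> - of_int k * \<delta>))"
    unfolding jumps_after_def k_def[symmetric]
    by (intro has_bochner_integral_add has_bochner_integral_mult_right
          has_bochner_integral_indicator_Ico) (use assms k in auto)
  moreover have "has_bochner_integral lborel (jumps_before \<delta> \<tau> m)
      (of_int k * \<delta> + (\<tau> - of_int k * \<delta>))"
    unfolding jumps_before_def k_def[symmetric]
    by (intro has_bochner_integral_add has_bochner_integral_mult_right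
          has_bochner_integral_indicator_Ico) (use assms k in auto)
  ultimately show "has_bochner_integral lborel (jumps_after \<delta> \<tau> m) \<tau>"
    "has_bochner_integral lborel (jumps_before \<delta> \<tau> m) \<tau>" by simp_all
qed

section \<open>An integrable majorant for the time translate\<close>

definition step_ext :: "nat \<Rightarrow> (nat \<Rightarrow> 'a \<Rightarrow> real) \<Rightarrow> int \<Rightarrow> 'a \<Rightarrow> real" where
  "step_ext N u k = (if 0 \<le> k \<and> k < int N then u (nat k) else (\<lambda>x. 0))"

text \<open>The weight \<open>l\<close> covers the times at which only one of \<open>t\<close> and
  \<open>t + \<tau>\<close> lies in a step below \<open>N\<close>. The weight \<open>d n\<close> is
  active when the grid point \<open>real (n + 1) * \<delta>\<close> lies in
  \<open>(t, t + \<tau>]\<close>. The weight \<open>e m\<close> is counted per jump, once with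
  \<open>m\<close> as the later step and once as the earlier one.\<close>

definition translate_majorant ::
  "real \<Rightarrow> real \<Rightarrow> nat \<Rightarrow> real \<Rightarrow> (nat \<Rightarrow> real) \<Rightarrow> (nat \<Rightarrow> real) \<Rightarrow> real \<Rightarrow> real" where
  "translate_majorant \<delta> \<tau> N l d e t =
     l * (indicator {-\<tau>..<0} t + indicator {real N * \<delta> - \<tau>..<real N * \<delta>} t)
     + (\<Sum>n<N. d n * indicator {real (n + 1) * \<delta> - \<tau>..<real (n + 1) * \<delta>} t)
     + (\<Sum>m<N. e m * (jumps_before \<delta> \<tau> m t + jumps_after \<delta> \<tau> m t))"

text \<open>With \<open>d\<close> carrying \<open>\<delta> / 2\<close> and \<open>e\<close> carrying
  \<open>\<delta>\<close>, these multiples of \<open>\<tau>\<close> become the constants 2, 1/2 and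
  2 of the theorem.\<close>

lemma translate_majorant_has_integral:
  assumes "0 < \<delta>" "0 \<le> \<tau>"
  shows "has_bochner_integral lborel (translate_majorant \<delta> \<tau> N l d e)
    (l * (\<tau> + \<tau>) + (\<Sum>n<N. d n * \<tau>) + (\<Sum>m<N. e m * (\<tau> + \<tau>)))"
  unfolding translate_majorant_def
  by (intro has_bochner_integral_add has_bochner_integral_mult_right has_bochner_integral_sum
        has_bochner_integral_indicator_Ico jumps_has_integral)
    (use assms in auto)

text \<open>The signs are stated separately because each case of the comparison below uses some
  parts and drops the others.\<close>

lemma translate_majorant_parts_nonneg:
  fixes l \<delta> \<tau> t :: real and d e :: "nat \<Rightarrow> real"
  assumes "0 < \<delta>" "0 \<le> \<tau>" "0 \<le> l" "\<And>n. 0 \<le> d n" "\<And>n. 0 \<le> e n"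
  shows "0 \<le> l * (indicator {-\<tau>..<0} t + indicator {real N * \<delta> - \<tau>..<real N * \<delta>} t)"
    and "0 \<le> (\<Sum>n<N. d n * indicator {real (n + 1) * \<delta> - \<tau>..<real (n + 1) * \<delta>} t)"
    and "0 \<le> (\<Sum>m<N. e m * (jumps_before \<delta> \<tau> m t + jumps_after \<delta> \<tau> m t))"
  using assms jumps_nonneg[OF assms(1,2)]
  by (auto intro!: sum_nonneg mult_nonneg_nonneg add_nonneg_nonneg)

context mesh_norm
begin

lemma translate_le_majorant:
  assumes u: "\<And>n. n \<le> N \<Longrightarrow> u n \<in> H_mesh M" and \<delta>: "0 < \<delta>" and \<tau>: "0 \<le> \<tau>"
    and l: "\<And>n. n < N \<Longrightarrow> (L2_norm \<Omega> (u n))\<^sup>2 \<le> l" "0 \<le> l"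
  shows "(L2_norm \<Omega> (\<lambda>x. step_ext N u \<lfloor>(t + \<tau>) / \<delta>\<rfloor> x - step_ext N u \<lfloor>t / \<delta>\<rfloor> x))\<^sup>2
    \<le> translate_majorant \<delta> \<tau> N l
        (\<lambda>n. \<delta> / 2 * (dual_norm \<Omega> M \<nu> (discrete_dt \<delta> u n))\<^sup>2) (\<lambda>n. \<delta> * (\<nu> (u n))\<^sup>2) t"
    (is "?lhs \<le> translate_majorant _ _ _ _ ?d ?e _")
proof -
  define i where "i = \<lfloor>(t + \<tau>) / \<delta>\<rfloor>"
  define j where "j = \<lfloor>t / \<delta>\<rfloor>"
  have i: "of_int i * \<delta> \<le> t + \<tau>" "t + \<tau> < of_int i * \<delta> + \<delta>"
    using floor_divide_eq_iff[OF \<delta>] i_def by blast+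
  have j: "of_int j * \<delta> \<le> t" "t < of_int j * \<delta> + \<delta>"
    using floor_divide_eq_iff[OF \<delta>] j_def by blast+
  have ji: "j \<le> i"
    unfolding i_def j_def using \<delta> \<tau> by (intro floor_mono divide_right_mono) auto
  note nonneg = translate_majorant_parts_nonneg[OF \<delta> \<tau> l(2), of ?d ?e]
  have d0: "\<And>n. 0 \<le> ?d n" and e0: "\<And>n. 0 \<le> ?e n" using \<delta> by auto
  note nonneg = nonneg[OF d0 e0]
  \<comment> \<open>Together with \<open>less_j\<close>: the grid points with index
    \<open>k\<close>, where \<open>j < k\<close> and \<open>k \<le> i\<close>, are those passed
    between \<open>t\<close> and \<open>t + \<tau>\<close>.\<close>
  have le_i: "of_int k * \<delta> \<le> t + \<tau>" if "k \<le> i" for k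
  proof -
    have "real_of_int k * \<delta> \<le> of_int i * \<delta>"
      using that \<delta> by (intro mult_right_mono) auto
    then show ?thesis using i by linarith
  qed
  have less_j: "t < of_int k * \<delta>" if "j < k" for k
  proof -
    have "real_of_int (j + 1) * \<delta> \<le> of_int k * \<delta>"
      using that \<delta> by (intro mult_right_mono) auto
    then show ?thesis using j by (simp add: distrib_right)
  qed
  have single: "(L2_norm \<Omega> (step_ext N u k))\<^sup>2 \<le> l" if "0 \<le> k" "k < int N" for k
    using l(1)[of "nat k"] that by (simp add: step_ext_def)
  have outer: "?lhs \<le> translate_majorant \<delta> \<tau> N l ?d ?e t"
    if "?lhs \<le> l" "t \<in> {-\<tau>..<0} \<or> t \<in> {real N * \<delta> - \<tau>..<real N * \<delta>}"
  proof -
    have "l * 1 \<le> l * (indicator {-\<tau>..<0} t + indicator {real N * \<delta> - \<tau>..<real N * \<delta>} t)"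
      using that(2) l(2) by (intro mult_left_mono) (auto simp: indicator_def)
    then show ?thesis
      using that(1) nonneg(2,3)[of t N] unfolding translate_majorant_def by linarith
  qed
  \<comment> \<open>Each of the steps \<open>j \<le> i\<close> lies before, inside or after
    \<open>{0..<N}\<close>. Exactly one lies inside in cases 2 and 5, both in case 4, none in the
    other three.\<close>
  consider "j < 0" "i < 0" | "j < 0" "0 \<le> i" "i < int N" | "j < 0" "int N \<le> i"
    | "0 \<le> j" "j < int N" "i < int N" | "0 \<le> j" "j < int N" "int N \<le> i" | "int N \<le> j"
    by linarith
  then show ?thesis
  proof cases
    case 2
    have "?lhs \<le> l"
      using single[of i] 2 by (simp add: i_def[symmetric] j_def[symmetric] step_ext_def)
    moreover have "-\<tau> \<le> t" "t < 0"
      using le_i[of 0] less_j[of 0] 2 by auto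
    ultimately show ?thesis using outer by simp
  next
    case 5
    have "?lhs \<le> l"
      using single[of j] 5
      by (simp add: i_def[symmetric] j_def[symmetric] step_ext_def L2_norm_def)
    moreover have "real N * \<delta> - \<tau> \<le> t" "t < real N * \<delta>"
      using le_i[of "int N"] less_j[of "int N"] 5 by auto
    ultimately show ?thesis using outer by simp
  next
    case 4
    then obtain a b where ab: "j = int a" "i = int b" "a \<le> b" "b < N"
      using ji by (metis nonneg_int_cases of_nat_le_iff of_nat_less_iff order_trans)
    have q: "?lhs = (L2_norm \<Omega> (\<lambda>x. u b x - u a x))\<^sup>2"
      using ab by (simp add: i_def[symmetric] j_def[symmetric] step_ext_def)
    have incr: "(L2_norm \<Omega> (\<lambda>x. u b x - u a x))\<^sup>2
        \<le> (\<Sum>n\<in>{a..<b}. ?d n) + ?e b * (real b - real a) + ?e a * (real b - real a)"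
      using increment_le[of N u \<delta> a b, OF u \<delta>] ab by simp
    have sum_d: "(\<Sum>n\<in>{a..<b}. ?d n)
        \<le> (\<Sum>n<N. ?d n * indicator {real (n + 1) * \<delta> - \<tau>..<real (n + 1) * \<delta>} t)"
    proof -
      \<comment> \<open>The jump from step \<open>n\<close> to step \<open>n + 1\<close> sits at the
        grid point with index \<open>n + 1\<close>, hence the shift.\<close>
      have "real (n + 1) * \<delta> - \<tau> \<le> t \<and> t < real (n + 1) * \<delta>" if "n \<in> {a..<b}" for n
        using le_i[of "int (n + 1)"] less_j[of "int (n + 1)"] that ab by auto
      then have "(\<Sum>n\<in>{a..<b}. ?d n)
          = (\<Sum>n\<in>{a..<b}. ?d n * indicator {real (n + 1) * \<delta> - \<tau>..<real (n + 1) * \<delta>} t)"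
        by (intro sum.cong) auto
      also have "\<dots> \<le> (\<Sum>n<N. ?d n * indicator {real (n + 1) * \<delta> - \<tau>..<real (n + 1) * \<delta>} t)"
        using ab \<delta> by (intro sum_mono2) auto
      finally show ?thesis .
    qed
    \<comment> \<open>At this \<open>t\<close> both counts equal \<open>b - a\<close>; each is a
      single nonnegative summand of the corresponding sum over \<open>m\<close>.\<close>
    have before: "real b - real a = jumps_before \<delta> \<tau> b t"
      using jumps_before_eq[OF \<delta>] ab i_def j_def by fastforce
    have sum_before: "?e b * jumps_before \<delta> \<tau> b t \<le> (\<Sum>m<N. ?e m * jumps_before \<delta> \<tau> m t)"
      using ab \<delta> jumps_nonneg[OF \<delta> \<tau>]
      by (intro member_le_sum[where f = "\<lambda>m. ?e m * jumps_before \<delta> \<tau> m t"]) auto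
    have after: "real b - real a = jumps_after \<delta> \<tau> a t"
      using jumps_after_eq[OF \<delta>] ab i_def j_def by fastforce
    have sum_after: "?e a * jumps_after \<delta> \<tau> a t \<le> (\<Sum>m<N. ?e m * jumps_after \<delta> \<tau> m t)"
      using ab \<delta> jumps_nonneg[OF \<delta> \<tau>]
      by (intro member_le_sum[where f = "\<lambda>m. ?e m * jumps_after \<delta> \<tau> m t"]) auto
    have "?lhs \<le> (\<Sum>n<N. ?d n * indicator {real (n + 1) * \<delta> - \<tau>..<real (n + 1) * \<delta>} t)
        + (\<Sum>m<N. ?e m * jumps_before \<delta> \<tau> m t) + (\<Sum>m<N. ?e m * jumps_after \<delta> \<tau> m t)"
      using q incr sum_d sum_before sum_after unfolding before[symmetric] after[symmetric]
      by linarith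
    then show ?thesis
      using nonneg(1)[of t N] unfolding translate_majorant_def distrib_left sum.distrib by linarith
  \<comment> \<open>In cases 1, 3 and 6 both values are zero; in case 3 the translation leaps over
    the whole time interval.\<close>
  qed (use nonneg[of t N] ji in \<open>auto simp: i_def[symmetric] j_def[symmetric] step_ext_def
        translate_majorant_def L2_norm_def\<close>)
qed

end

section \<open>Integration over space and time\<close>

text \<open>As \<open>T\<close> is \<open>N\<close> steps long, \<open>[0, T)\<close> consists of
  the steps below \<open>N\<close>, and \<open>u N\<close> never enters. \<open>step_ext\<close>
  takes an integer index because \<open>nat\<close> would send negative times to step 0.\<close>

lemma zero_extension_spacetime_fun:
  assumes "0 < \<delta>" "T = real N * \<delta>"
  shows "zero_extension (\<Omega> \<times> {0..<T}) (spacetime_fun \<delta> u) (x, t)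
    = indicator \<Omega> x * step_ext N u \<lfloor>t / \<delta>\<rfloor> x"
proof -
  have "t \<in> {0..<T} \<longleftrightarrow> 0 \<le> \<lfloor>t / \<delta>\<rfloor> \<and> \<lfloor>t / \<delta>\<rfloor> < int N"
    using assms by (simp add: floor_less_iff field_simps)
  then show ?thesis
    by (auto simp: zero_extension_def spacetime_fun_def step_ext_def)
qed

context mesh_norm
begin

lemma step_ext_in_H_mesh:
  assumes "\<And>n. n \<le> N \<Longrightarrow> u n \<in> H_mesh M"
  shows "step_ext N u k \<in> H_mesh M"
  unfolding step_ext_def using assms by (cases "0 \<le> k \<and> k < int N") (auto intro: zero_in_H_mesh)

text \<open>The majorant is integrated for nonnegative shifts, and a change of variable handles
  negative ones. With the nonnegative integral, integrability of the left side is no issue.\<close>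

lemma nn_integral_translate_le:
  assumes u: "\<And>n. n \<le> N \<Longrightarrow> u n \<in> H_mesh M" and \<delta>: "0 < \<delta>"
    and l: "\<And>n. n < N \<Longrightarrow> (L2_norm \<Omega> (u n))\<^sup>2 \<le> l" "0 \<le> l"
  shows "(\<integral>\<^sup>+t. ennreal ((L2_norm \<Omega> (\<lambda>x. step_ext N u \<lfloor>(t + \<tau>) / \<delta>\<rfloor> x - step_ext N u \<lfloor>t / \<delta>\<rfloor> x))\<^sup>2)
        \<partial>lborel)
    \<le> ennreal (\<bar>\<tau>\<bar> * (2 * (\<Sum>m<N. \<delta> * (\<nu> (u m))\<^sup>2)
        + 1 / 2 * (\<Sum>n<N. \<delta> * (dual_norm \<Omega> M \<nu> (discrete_dt \<delta> u n))\<^sup>2) + 2 * l))"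
proof -
  define Q where "Q i j = (L2_norm \<Omega> (\<lambda>x. step_ext N u i x - step_ext N u j x))\<^sup>2" for i j
  define R where "R = 2 * (\<Sum>m<N. \<delta> * (\<nu> (u m))\<^sup>2)
    + 1 / 2 * (\<Sum>n<N. \<delta> * (dual_norm \<Omega> M \<nu> (discrete_dt \<delta> u n))\<^sup>2) + 2 * l"
  have pos: "(\<integral>\<^sup>+t. ennreal (Q \<lfloor>(t + s) / \<delta>\<rfloor> \<lfloor>t / \<delta>\<rfloor>) \<partial>lborel) \<le> ennreal (s * R)"
    if s: "0 \<le> s" for s
  proof -
    let ?d = "\<lambda>n. \<delta> / 2 * (dual_norm \<Omega> M \<nu> (discrete_dt \<delta> u n))\<^sup>2"
    let ?e = "\<lambda>n. \<delta> * (\<nu> (u n))\<^sup>2"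
    let ?W = "translate_majorant \<delta> s N l ?d ?e"
    have le: "Q \<lfloor>(t + s) / \<delta>\<rfloor> \<lfloor>t / \<delta>\<rfloor> \<le> ?W t" for t
      unfolding Q_def by (rule translate_le_majorant[OF u \<delta> s l])
    have W0: "0 \<le> ?W t" for t
      using le[of t] by (rule order_trans[rotated]) (simp add: Q_def)
    note W = translate_majorant_has_integral[OF \<delta> s, of N l ?d ?e]
    have "(\<integral>\<^sup>+t. ennreal (Q \<lfloor>(t + s) / \<delta>\<rfloor> \<lfloor>t / \<delta>\<rfloor>) \<partial>lborel) \<le> (\<integral>\<^sup>+t. ennreal (?W t) \<partial>lborel)"
      by (intro nn_integral_mono ennreal_leI le)
    also have "\<dots> = ennreal (l * (s + s) + (\<Sum>n<N. ?d n * s) + (\<Sum>m<N. ?e m * (s + s)))"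
      using W W0 by (subst nn_integral_eq_integral)
        (auto simp: has_bochner_integral_iff)
    also have "l * (s + s) + (\<Sum>n<N. ?d n * s) + (\<Sum>m<N. ?e m * (s + s)) = s * R"
      by (simp add: R_def sum_distrib_left sum_distrib_right algebra_simps sum.distrib)
    finally show ?thesis .
  qed
  \<comment> \<open>The integrand depends on \<open>t\<close> only through two integers, so it
    factors through a countable discrete space.\<close>
  have meas: "(\<lambda>t. ennreal (Q \<lfloor>(t + \<tau>) / \<delta>\<rfloor> \<lfloor>t / \<delta>\<rfloor>)) \<in> borel_measurable borel"
  proof -
    have "(\<lambda>t. ennreal (case_prod Q (\<lfloor>(t + \<tau>) / \<delta>\<rfloor>, \<lfloor>t / \<delta>\<rfloor>))) \<in> borel_measurable borel"
      by (rule measurable_compose[where N = "count_space UNIV \<Otimes>\<^sub>M count_space UNIV"])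
        (auto simp: pair_measure_countable)
    then show ?thesis by simp
  qed
  have sym: "Q i j = Q j i" for i j
    by (simp add: Q_def L2_norm_def power2_commute)
  have "(\<integral>\<^sup>+t. ennreal (Q \<lfloor>(t + \<tau>) / \<delta>\<rfloor> \<lfloor>t / \<delta>\<rfloor>) \<partial>lborel) \<le> ennreal (\<bar>\<tau>\<bar> * R)"
  proof (cases "0 \<le> \<tau>")
    case True
    then show ?thesis using pos by simp
  next
    case False
    \<comment> \<open>Replacing \<open>t\<close> by \<open>t - \<tau>\<close> exchanges the roles of
      the two times; symmetry of \<open>Q\<close> then leaves the positive shift
      \<open>-\<tau>\<close>.\<close>
    have "(\<integral>\<^sup>+t. ennreal (Q \<lfloor>(t + \<tau>) / \<delta>\<rfloor> \<lfloor>t / \<delta>\<rfloor>) \<partial>lborel)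
        = (\<integral>\<^sup>+t. ennreal (Q \<lfloor>t / \<delta>\<rfloor> \<lfloor>(t + (-\<tau>)) / \<delta>\<rfloor>) \<partial>lborel)"
      by (subst nn_integral_real_affine[OF meas, of 1 "-\<tau>"]) (simp_all add: add.commute)
    also have "\<dots> \<le> ennreal (-\<tau> * R)"
      using pos[of "-\<tau>"] False by (subst sym) simp
    finally show ?thesis using False by simp
  qed
  then show ?thesis unfolding Q_def R_def .
qed

text \<open>By Tonelli the space integral is taken first. At fixed \<open>t\<close> it is the
  squared norm over \<open>\<Omega>\<close> of the difference of two mesh functions, which the
  preceding lemma integrates in time.\<close>

lemma L2_norm_translate_le:
  assumes u: "\<And>n. n \<le> N \<Longrightarrow> u n \<in> H_mesh M" and \<delta>: "0 < \<delta>" and T: "T = real N * \<delta>"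
    and l: "\<And>n. n < N \<Longrightarrow> (L2_norm \<Omega> (u n))\<^sup>2 \<le> l" "0 \<le> l"
    and f: "f = zero_extension (\<Omega> \<times> {0..<T}) (spacetime_fun \<delta> u)"
  shows "(L2_norm UNIV (\<lambda>(x, t). f (x, t + \<tau>) - f (x, t)))\<^sup>2
    \<le> \<bar>\<tau>\<bar> * (2 * (\<Sum>m<N. \<delta> * (\<nu> (u m))\<^sup>2)
        + 1 / 2 * (\<Sum>n<N. \<delta> * (dual_norm \<Omega> M \<nu> (discrete_dt \<delta> u n))\<^sup>2) + 2 * l)"
    (is "_ \<le> ?R")
proof -
  let ?U = "step_ext N u"
  let ?g = "\<lambda>z. (case z of (x, t) \<Rightarrow> f (x, t + \<tau>) - f (x, t))\<^sup>2"
  have f_eq: "f (x, t) = indicator \<Omega> x * ?U \<lfloor>t / \<delta>\<rfloor> x" for x t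
    unfolding f by (rule zero_extension_spacetime_fun[OF \<delta> T])
  have U: "?U k \<in> H_mesh M" for k
    using u by (rule step_ext_in_H_mesh)
  have [measurable]: "?U k \<in> borel_measurable borel" for k
    using measurable_H_mesh[OF U] .
  have [measurable]: "\<Omega> \<in> sets borel"
    using open_domain by simp
  have fs: "(\<lambda>(x, t). f (x, t + s)) \<in> borel_measurable (borel \<Otimes>\<^sub>M borel)" for s
  proof -
    \<comment> \<open>For a fixed step \<open>k\<close> the function is measurable in space, and
      only countably many steps occur.\<close>
    have "(\<lambda>z. (\<lambda>k z. indicator \<Omega> (fst z) * ?U k (fst z)) \<lfloor>(snd z + s) / \<delta>\<rfloor> z)
        \<in> borel_measurable (borel \<Otimes>\<^sub>M borel)"
      by (rule measurable_compose_countable) measurable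
    then show ?thesis by (simp add: f_eq split_beta)
  qed
  \<comment> \<open>The shift by 0 makes both terms instances of \<open>fs\<close>.\<close>
  have "(\<lambda>z. (f (fst z, snd z + \<tau>) - f (fst z, snd z + 0))\<^sup>2) \<in> borel_measurable (borel \<Otimes>\<^sub>M borel)"
    using fs[of \<tau>] fs[of 0] unfolding split_beta by measurable
  then have g: "(\<lambda>z. ennreal (?g z)) \<in> borel_measurable (lborel \<Otimes>\<^sub>M lborel)"
    by (simp add: split_beta)
  have inner: "(\<integral>\<^sup>+x. ennreal (?g (x, t)) \<partial>lborel)
      = ennreal ((L2_norm \<Omega> (\<lambda>x. ?U \<lfloor>(t + \<tau>) / \<delta>\<rfloor> x - ?U \<lfloor>t / \<delta>\<rfloor> x))\<^sup>2)" for t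
  proof -
    let ?v = "\<lambda>x. ?U \<lfloor>(t + \<tau>) / \<delta>\<rfloor> x - ?U \<lfloor>t / \<delta>\<rfloor> x"
    have v: "?v \<in> H_mesh M" by (intro H_mesh_diff U)
    have "?g (x, t) = indicator \<Omega> x *\<^sub>R (?v x * ?v x)" for x
      by (simp add: f_eq power2_eq_square indicator_def)
    then have "(\<integral>\<^sup>+x. ennreal (?g (x, t)) \<partial>lborel)
        = (\<integral>\<^sup>+x. ennreal (indicator \<Omega> x *\<^sub>R (?v x * ?v x)) \<partial>lborel)"
      by simp
    also have "\<dots> = ennreal (LINT x|lborel. indicator \<Omega> x *\<^sub>R (?v x * ?v x))"
      using integrable_ip[OF v v] unfolding set_integrable_def
      by (intro nn_integral_eq_integral) auto
    also have "(LINT x|lborel. indicator \<Omega> x *\<^sub>R (?v x * ?v x)) = (L2_norm \<Omega> ?v)\<^sup>2"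
      unfolding ip_self[symmetric] ip_def set_lebesgue_integral_def ..
    finally show ?thesis .
  qed
  have R0: "0 \<le> ?R"
    using l(2) \<delta> by (intro mult_nonneg_nonneg add_nonneg_nonneg sum_nonneg) auto
  have "(\<integral>\<^sup>+z. ennreal (?g z) \<partial>lborel) = (\<integral>\<^sup>+t. (\<integral>\<^sup>+x. ennreal (?g (x, t)) \<partial>lborel) \<partial>lborel)"
    unfolding lborel_prod[symmetric] by (rule lborel_pair.nn_integral_snd[OF g, symmetric])
  also have "\<dots> \<le> ennreal ?R"
    unfolding inner by (rule nn_integral_translate_le[OF u \<delta> l])
  finally have "(LINT z|lborel. ?g z) \<le> ?R"
    by (rule integral_real_bounded[OF R0])
  \<comment> \<open>Nonnegativity lets the square cancel the root in \<open>L2_norm\<close>.\<close>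
  moreover have "0 \<le> (LINT z|lborel. ?g z)"
    by (intro integral_nonneg_AE) auto
  ultimately show ?thesis
    by (simp add: L2_norm_def set_lebesgue_integral_def)
qed

end

section \<open>Application to simplicial meshes\<close>

lemma mesh_norm_if_simplicial_mesh:
  assumes "polyhedral_domain \<Omega>" "simplicial_mesh \<Omega> M" "norm_on (H_mesh M) \<nu>"
  shows "mesh_norm \<Omega> M \<nu>"
proof
  show "open \<Omega>" "bounded \<Omega>"
    using assms(1) by (auto simp: polyhedral_domain_def)
  \<comment> \<open>Cells are nonempty because each contains a circumcenter.\<close>
  show "finite M" "disjoint M" "{} \<notin> M"
    using assms(2) unfolding simplicial_mesh_def by blast+
  show "open K" if "K \<in> M" for K
    using assms(2) that by (auto simp: simplicial_mesh_def open_simplex_def)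
  show "norm_on (H_mesh M) \<nu>"
    by (rule assms(3))
qed

theorem theoremA1:
  fixes \<Omega> :: "(real ^ 'd) set" and M :: "(real ^ 'd) set set"
    and N :: nat and T \<delta>t \<tau> :: real
    and \<nu> :: "((real ^ 'd) \<Rightarrow> real) \<Rightarrow> real"
    and u :: "nat \<Rightarrow> (real ^ 'd) \<Rightarrow> real"
    and u_hat :: "(real ^ 'd) \<times> real \<Rightarrow> real"
  assumes "CARD('d) = 2 \<or> CARD('d) = 3"
    and "polyhedral_domain \<Omega>"
    and "simplicial_mesh \<Omega> M"
    and "N \<ge> 1" and "0 < T" and "\<delta>t = T / real N"
    and "norm_on (H_mesh M) \<nu>"
    and "\<And>n. n \<le> N \<Longrightarrow> u n \<in> H_mesh M"
    and "u_hat = zero_extension (\<Omega> \<times> {0..<T}) (spacetime_fun \<delta>t u)"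
  shows "(L2_norm UNIV (\<lambda>(x, t). u_hat (x, t + \<tau>) - u_hat (x, t)))\<^sup>2
    \<le> \<bar>\<tau>\<bar> * (2 * (L2_H_norm \<nu> \<delta>t N u)\<^sup>2
             + 1 / 2 * (L2_H_dual_norm \<Omega> M \<nu> \<delta>t N (discrete_dt \<delta>t u))\<^sup>2
             + 2 * (Linf_L2_norm \<Omega> N u)\<^sup>2)"
proof -
  interpret mesh_norm \<Omega> M \<nu>
    using assms by (intro mesh_norm_if_simplicial_mesh)
  have \<delta>: "0 < \<delta>t" and T: "T = real N * \<delta>t"
    using assms by auto
  have L2_nonneg: "0 \<le> L2_norm \<Omega> v" for v
    unfolding L2_norm_def set_lebesgue_integral_def
    by (intro real_sqrt_ge_zero integral_nonneg_AE) auto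
  have "(L2_norm \<Omega> (u n))\<^sup>2 \<le> (Linf_L2_norm \<Omega> N u)\<^sup>2" if "n < N" for n
    unfolding Linf_L2_norm_def using that by (intro power_mono Max_ge L2_nonneg) auto
  then have "(L2_norm UNIV (\<lambda>(x, t). u_hat (x, t + \<tau>) - u_hat (x, t)))\<^sup>2
    \<le> \<bar>\<tau>\<bar> * (2 * (\<Sum>m<N. \<delta>t * (\<nu> (u m))\<^sup>2)
        + 1 / 2 * (\<Sum>n<N. \<delta>t * (dual_norm \<Omega> M \<nu> (discrete_dt \<delta>t u n))\<^sup>2)
        + 2 * (Linf_L2_norm \<Omega> N u)\<^sup>2)"
    using L2_norm_translate_le[of N u, OF assms(8) \<delta> T _ _ assms(9)] by simp
  also have "(\<Sum>n<N. \<delta>t * (dual_norm \<Omega> M \<nu> (discrete_dt \<delta>t u n))\<^sup>2)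
      = (L2_H_dual_norm \<Omega> M \<nu> \<delta>t N (discrete_dt \<delta>t u))\<^sup>2"
  proof -
    \<comment> \<open>Subtraction on naturals truncates, so \<open>N \<ge> 1\<close> matters
      here.\<close>
    have "{0..N-1} = {..<N}" using \<open>N \<ge> 1\<close> by auto
    then show ?thesis using \<delta> by (simp add: L2_H_dual_norm_def sum_nonneg)
  qed
  also have "\<bar>\<tau>\<bar> * (2 * (\<Sum>m<N. \<delta>t * (\<nu> (u m))\<^sup>2)
        + 1 / 2 * (L2_H_dual_norm \<Omega> M \<nu> \<delta>t N (discrete_dt \<delta>t u))\<^sup>2
        + 2 * (Linf_L2_norm \<Omega> N u)\<^sup>2)
    \<le> \<bar>\<tau>\<bar> * (2 * (L2_H_norm \<nu> \<delta>t N u)\<^sup>2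
        + 1 / 2 * (L2_H_dual_norm \<Omega> M \<nu> \<delta>t N (discrete_dt \<delta>t u))\<^sup>2
        + 2 * (Linf_L2_norm \<Omega> N u)\<^sup>2)"
  proof -
    \<comment> \<open>The space-time norm also counts the final value \<open>u N\<close>, which only
      enlarges the bound.\<close>
    have "(\<Sum>m<N. \<delta>t * (\<nu> (u m))\<^sup>2) \<le> (\<Sum>m=0..N. \<delta>t * (\<nu> (u m))\<^sup>2)"
      using \<delta> by (intro sum_mono2) auto
    also have "\<dots> = (L2_H_norm \<nu> \<delta>t N u)\<^sup>2"
      using \<delta> by (simp add: L2_H_norm_def sum_nonneg)
    finally show ?thesis by (intro mult_left_mono) auto
  qed
  finally show ?thesis .
qed

end
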